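(* Let $K$ be a field of characteristic $0$ and $X$ a finite or countable set of variables. (i) For $\#X\geq n$, let $f$ be a pseudo-linear element in $n$ variables. Then for all pseudo-linear $g_1,\dots,g_n$, the composition $f(g_1,\dots,g_n)$, obtained by substituting $g_i$ for the $i$-th variable, is again pseudo-linear. (ii) If $\#X\geq 2$, each Lie polynomial $f=\sum\alpha_{i_1,\dots,i_r}\,x_{i_1}\cdots x_{i_r}$ over $X$ in associative variables induces a pseudo-linear element $\sum\alpha_{i_1,\dots,i_r}\,x_{i_1}(x_{i_2}(\cdots x_{i_r})\cdots)$ of $K\{X\}$, with right normed brackets inserted.
   Context: $K\{X\}$ is the free unital, not necessarily associative or commutative, $K$-algebra on $X$. The co-addition is the unital algebra homomorphism $\Delta:K\{X\}\to K\{X\}\otimes K\{X\}$ (component-wise multiplication) with $\Delta(x_i)=x_i\otimes 1+1\otimes x_i$ for all $x_i\in X$. An element $f$ is called pseudo-linear (or primitive) if $\Delta(f)=f\otimes 1+1\otimes f$. A Lie polynomial over $X$ is an element of the Lie subalgebra generated by $X$ in the free associative algebra $K\langle X\rangle$ (with the commutator bracket). *)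

theory Defs
  imports "HOL-Library.Poly_Mapping" "HOL-Library.Countable_Set"
begin

section \<open>Algebras of unital magmas\<close>

text \<open>
  For a unital magma \<open>M\<close> the type \<open>M \<Rightarrow>\<^sub>0 K\<close> is the \<open>K\<close>-vector space with basis \<open>M\<close>.
  The product of the library on this type is available for (associative) monoids only,
  so the bilinear extension of a nonassociative operation is introduced here.
\<close>

class unital_magma =
  fixes mone :: 'a
    and mprod :: "'a \<Rightarrow> 'a \<Rightarrow> 'a"
  assumes mprod_mone_left [simp]: "mprod mone a = a"
    and mprod_mone_right [simp]: "mprod a mone = a"

instantiation prod :: (unital_magma, unital_magma) unital_magma
begin

definition mone_prod_def: "mone = (mone, mone)"

definition mprod_prod_def: "mprod p q = (mprod (fst p) (fst q), mprod (snd p) (snd q))"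

instance
  by standard (simp_all add: mone_prod_def mprod_prod_def)

end

lemma mprod_Pair [simp]: "mprod (a, b) (c, d) = (mprod a c, mprod b d)"
  by (simp add: mprod_prod_def)

definition smult :: "'k::comm_ring_1 \<Rightarrow> ('m \<Rightarrow>\<^sub>0 'k) \<Rightarrow> ('m \<Rightarrow>\<^sub>0 'k)"
  where "smult c f = Poly_Mapping.map ((*) c) f"

abbreviation basis :: "'m \<Rightarrow> ('m \<Rightarrow>\<^sub>0 'k::comm_ring_1)"
  where "basis m \<equiv> Poly_Mapping.single m 1"

definition lin_ext :: "('m \<Rightarrow> ('n \<Rightarrow>\<^sub>0 'k::comm_ring_1)) \<Rightarrow> ('m \<Rightarrow>\<^sub>0 'k) \<Rightarrow> ('n \<Rightarrow>\<^sub>0 'k)"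
  where "lin_ext \<phi> f = (\<Sum>m\<in>Poly_Mapping.keys f. smult (Poly_Mapping.lookup f m) (\<phi> m))"

definition algone :: "'m::unital_magma \<Rightarrow>\<^sub>0 'k::comm_ring_1"
  where "algone = basis mone"

definition algmult :: "('m::unital_magma \<Rightarrow>\<^sub>0 'k::comm_ring_1) \<Rightarrow> ('m \<Rightarrow>\<^sub>0 'k) \<Rightarrow> ('m \<Rightarrow>\<^sub>0 'k)"
    (infixl \<open>\<star>\<close> 70)
  where "f \<star> g = lin_ext (\<lambda>a. lin_ext (\<lambda>b. basis (mprod a b)) g) f"

text \<open>
  The tensor product of the spaces with bases \<open>M\<close> and \<open>N\<close> is the space with basis
  \<open>M \<times> N\<close>.  Its algebra structure, taken from the product magma, is the component-wise one;
  see \<open>tensor_algmult\<close> below.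
\<close>

definition tensor :: "('m \<Rightarrow>\<^sub>0 'k::comm_ring_1) \<Rightarrow> ('n \<Rightarrow>\<^sub>0 'k) \<Rightarrow> ('m \<times> 'n \<Rightarrow>\<^sub>0 'k)"
    (infixl \<open>\<otimes>\<close> 75)
  where "f \<otimes> g = lin_ext (\<lambda>a. lin_ext (\<lambda>b. basis (a, b)) g) f"

definition unital_algebra_hom ::
    "(('m::unital_magma \<Rightarrow>\<^sub>0 'k::comm_ring_1) \<Rightarrow> ('n::unital_magma \<Rightarrow>\<^sub>0 'k)) \<Rightarrow> bool"
  where "unital_algebra_hom h \<longleftrightarrow>
    h algone = algone \<and>
    (\<forall>f g. h (f + g) = h f + h g) \<and>
    (\<forall>c f. h (smult c f) = smult c (h f)) \<and>
    (\<forall>f g. h (f \<star> g) = h f \<star> h g)"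


section \<open>The free unital nonassociative algebra\<close>

text \<open>
  A monomial is the empty monomial or a bracketed nonempty word in the variables.
\<close>

datatype 'x brword = Letter 'x | Bracket "'x brword" "'x brword"

datatype (monvars: 'x) nonassoc_mon = Unit | Brword "'x brword"

instantiation nonassoc_mon :: (type) unital_magma
begin

definition mone_nonassoc_mon_def: "mone = Unit"

fun mprod_nonassoc_mon :: "'a nonassoc_mon \<Rightarrow> 'a nonassoc_mon \<Rightarrow> 'a nonassoc_mon" where
  "mprod_nonassoc_mon Unit b = b"
| "mprod_nonassoc_mon (Brword s) Unit = Brword s"
| "mprod_nonassoc_mon (Brword s) (Brword t) = Brword (Bracket s t)"

instance
proof
  fix a :: "'a nonassoc_mon"
  show "mprod mone a = a" by (simp add: mone_nonassoc_mon_def)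
  show "mprod a mone = a" by (cases a) (simp_all add: mone_nonassoc_mon_def)
qed

end

type_synonym ('x, 'k) nonassoc_poly = "'x nonassoc_mon \<Rightarrow>\<^sub>0 'k"

definition gen :: "'x \<Rightarrow> ('x, 'k::comm_ring_1) nonassoc_poly"
  where "gen x = basis (Brword (Letter x))"

definition free_nonassoc :: "'x set \<Rightarrow> ('x, 'k::comm_ring_1) nonassoc_poly set"
  where "free_nonassoc X = {f. \<forall>m\<in>Poly_Mapping.keys f. monvars m \<subseteq> X}"

text \<open>
  \<open>hom_ext \<sigma>\<close> is the unital algebra homomorphism with \<open>x \<mapsto> \<sigma> x\<close> for every variable \<open>x\<close>;
  see \<open>hom_ext_hom\<close>, \<open>hom_ext_gen\<close> and \<open>hom_ext_unique\<close> below.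
\<close>

primrec eval_brword :: "('x \<Rightarrow> ('m::unital_magma \<Rightarrow>\<^sub>0 'k::comm_ring_1)) \<Rightarrow> 'x brword \<Rightarrow> ('m \<Rightarrow>\<^sub>0 'k)"
  where
  "eval_brword \<sigma> (Letter x) = \<sigma> x"
| "eval_brword \<sigma> (Bracket s t) = eval_brword \<sigma> s \<star> eval_brword \<sigma> t"

primrec eval_mon :: "('x \<Rightarrow> ('m::unital_magma \<Rightarrow>\<^sub>0 'k::comm_ring_1)) \<Rightarrow> 'x nonassoc_mon \<Rightarrow> ('m \<Rightarrow>\<^sub>0 'k)"
  where
  "eval_mon \<sigma> Unit = algone"
| "eval_mon \<sigma> (Brword t) = eval_brword \<sigma> t"

definition hom_ext ::
    "('x \<Rightarrow> ('m::unital_magma \<Rightarrow>\<^sub>0 'k::comm_ring_1)) \<Rightarrow> ('x, 'k) nonassoc_poly \<Rightarrow> ('m \<Rightarrow>\<^sub>0 'k)"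
  where "hom_ext \<sigma> = lin_ext (eval_mon \<sigma>)"

definition coaddition ::
    "('x, 'k::comm_ring_1) nonassoc_poly \<Rightarrow> ('x nonassoc_mon \<times> 'x nonassoc_mon \<Rightarrow>\<^sub>0 'k)"
  where "coaddition = hom_ext (\<lambda>x. gen x \<otimes> algone + algone \<otimes> gen x)"

definition pseudo_linear :: "'x set \<Rightarrow> ('x, 'k::comm_ring_1) nonassoc_poly set"
  where "pseudo_linear X =
    {f \<in> free_nonassoc X. coaddition f = f \<otimes> algone + algone \<otimes> f}"

text \<open>
  The variables \<open>v 0, \<dots>, v (n - 1)\<close> are meant to be distinct; \<open>g i\<close> is substituted for \<open>v i\<close>.
\<close>

definition composition ::
    "nat \<Rightarrow> (nat \<Rightarrow> 'x) \<Rightarrow> ('x, 'k::comm_ring_1) nonassoc_poly \<Rightarrow>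
     (nat \<Rightarrow> ('x, 'k) nonassoc_poly) \<Rightarrow> ('x, 'k) nonassoc_poly"
  where "composition n v f g = hom_ext (\<lambda>x. g (inv_into {..<n} v x)) f"


section \<open>Lie polynomials\<close>

text \<open>
  The free associative algebra is the algebra of the free monoid.  The library expects that
  monoid in additive notation, so \<open>+\<close> is concatenation on the type below.
\<close>

datatype 'x assoc_word = Assoc_Word (letters: "'x list")

instantiation assoc_word :: (type) monoid_add
begin

definition zero_assoc_word_def: "0 = Assoc_Word []"

definition plus_assoc_word_def: "u + w = Assoc_Word (letters u @ letters w)"

instance
  by standard (simp_all add: zero_assoc_word_def plus_assoc_word_def)

end

type_synonym ('x, 'k) assoc_poly = "'x assoc_word \<Rightarrow>\<^sub>0 'k"

inductive_set lie_polynomials :: "'x set \<Rightarrow> ('x, 'k::comm_ring_1) assoc_poly set"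
  for X :: "'x set" where
  gen: "x \<in> X \<Longrightarrow> basis (Assoc_Word [x]) \<in> lie_polynomials X"
| zero: "0 \<in> lie_polynomials X"
| add: "f \<in> lie_polynomials X \<Longrightarrow> g \<in> lie_polynomials X \<Longrightarrow> f + g \<in> lie_polynomials X"
| scale: "f \<in> lie_polynomials X \<Longrightarrow> smult c f \<in> lie_polynomials X"
| commutator: "f \<in> lie_polynomials X \<Longrightarrow> g \<in> lie_polynomials X \<Longrightarrow>
    f * g - g * f \<in> lie_polynomials X"

definition right_normed_mon :: "'x assoc_word \<Rightarrow> 'x nonassoc_mon"
  where "right_normed_mon w = foldr (\<lambda>x m. mprod (Brword (Letter x)) m) (letters w) mone"

definition right_normed :: "('x, 'k::comm_ring_1) assoc_poly \<Rightarrow> ('x, 'k) nonassoc_poly"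
  where "right_normed = lin_ext (\<lambda>w. basis (right_normed_mon w))"


section \<open>Universal properties\<close>

lemma lookup_smult [simp]: "Poly_Mapping.lookup (smult c f) m = c * Poly_Mapping.lookup f m"
  by (simp add: smult_def map.rep_eq when_def)

lemma smult_basis: "smult c (basis m) = Poly_Mapping.single m c"
  by (rule poly_mapping_eqI) (simp add: lookup_single when_def)

lemma smult_add: "smult c (f + g) = smult c f + smult c g"
  by (rule poly_mapping_eqI) (simp add: lookup_add algebra_simps)

lemma add_smult: "smult (c + d) f = smult c f + smult d f"
  by (rule poly_mapping_eqI) (simp add: lookup_add algebra_simps)

lemma smult_smult: "smult c (smult d f) = smult (c * d) f"
  by (rule poly_mapping_eqI) (simp add: algebra_simps)

lemma smult_0 [simp]: "smult 0 f = 0" "smult c 0 = 0"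
  by (rule poly_mapping_eqI, simp)+

lemma smult_1 [simp]: "smult 1 f = f"
  by (rule poly_mapping_eqI) simp

lemma smult_sum: "smult c (\<Sum>i\<in>I. f i) = (\<Sum>i\<in>I. smult c (f i))"
  by (rule poly_mapping_eqI) (simp add: lookup_sum sum_distrib_left)

lemma lin_ext_superset:
  assumes "finite S" "Poly_Mapping.keys f \<subseteq> S"
  shows "lin_ext \<phi> f = (\<Sum>m\<in>S. smult (Poly_Mapping.lookup f m) (\<phi> m))"
  unfolding lin_ext_def
  by (rule sum.mono_neutral_left) (use assms in \<open>auto simp: in_keys_iff\<close>)

lemma lin_ext_basis [simp]: "lin_ext \<phi> (basis m) = \<phi> m"
  by (simp add: lin_ext_def)

lemma lin_ext_zero [simp]: "lin_ext \<phi> 0 = 0"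
  by (simp add: lin_ext_def)

lemma lin_ext_add: "lin_ext \<phi> (f + g) = lin_ext \<phi> f + lin_ext \<phi> g"
proof -
  let ?S = "Poly_Mapping.keys f \<union> Poly_Mapping.keys g"
  have "Poly_Mapping.keys (f + g) \<subseteq> ?S"
    by (rule Poly_Mapping.keys_add)
  then show ?thesis
    by (simp add: lin_ext_superset[of ?S] lookup_add add_smult sum.distrib)
qed

lemma lin_ext_smult: "lin_ext \<phi> (smult c f) = smult c (lin_ext \<phi> f)"
proof -
  have "Poly_Mapping.keys (smult c f) \<subseteq> Poly_Mapping.keys f"
    by (auto simp: in_keys_iff)
  then show ?thesis
    by (simp add: lin_ext_superset[of "Poly_Mapping.keys f"] smult_sum smult_smult)
qed

lemma lin_ext_fun_add: "lin_ext (\<lambda>m. \<phi> m + \<psi> m) f = lin_ext \<phi> f + lin_ext \<psi> f"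
  by (simp add: lin_ext_def smult_add sum.distrib)

lemma lin_ext_fun_smult: "lin_ext (\<lambda>m. smult c (\<phi> m)) f = smult c (lin_ext \<phi> f)"
  by (simp add: lin_ext_def smult_sum smult_smult mult.commute)

lemma linear_induct [case_names basis zero add smult]:
  assumes "\<And>m. P (basis m)" "P 0" "\<And>f g. P f \<Longrightarrow> P g \<Longrightarrow> P (f + g)"
    and "\<And>c f. P f \<Longrightarrow> P (smult c f)"
  shows "P (f :: 'm \<Rightarrow>\<^sub>0 'k::comm_ring_1)"
proof -
  have "P (Poly_Mapping.single m c)" for m and c :: 'k
    using assms(4)[OF assms(1)[of m], of c] by (simp add: smult_basis)
  moreover have "f = (\<Sum>m\<in>Poly_Mapping.keys f. Poly_Mapping.single m (Poly_Mapping.lookup f m))"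
    by (rule poly_mapping_eqI) (auto simp: lookup_sum lookup_single when_def in_keys_iff)
  moreover have "P (\<Sum>m\<in>S. Poly_Mapping.single m (Poly_Mapping.lookup f m))" if "finite S" for S
    using that by induction (auto intro: assms calculation)
  ultimately show ?thesis
    by (metis finite_keys)
qed

lemma algmult_basis [simp]: "basis a \<star> basis b = basis (mprod a b)"
  by (simp add: algmult_def)

lemma algmult_linear:
  "(f + g) \<star> h = f \<star> h + g \<star> h" "h \<star> (f + g) = h \<star> f + h \<star> g"
  "smult c f \<star> g = smult c (f \<star> g)" "f \<star> smult c g = smult c (f \<star> g)"
  "0 \<star> g = 0" "f \<star> 0 = 0"
  by (simp_all add: algmult_def lin_ext_add lin_ext_smult lin_ext_fun_add lin_ext_fun_smult)
    (simp add: lin_ext_def)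

lemma algone_algmult [simp]: "algone \<star> f = f" "f \<star> algone = f"
  by (induction f rule: linear_induct) (simp_all add: algone_def algmult_linear)

lemma tensor_basis [simp]: "basis a \<otimes> basis b = basis (a, b)"
  by (simp add: tensor_def)

lemma tensor_linear:
  "(f + g) \<otimes> h = f \<otimes> h + g \<otimes> h" "h \<otimes> (f + g) = h \<otimes> f + h \<otimes> g"
  "smult c f \<otimes> h = smult c (f \<otimes> h)" "h \<otimes> smult c f = smult c (h \<otimes> f)"
  "0 \<otimes> h = 0" "h \<otimes> 0 = 0"
  by (simp_all add: tensor_def lin_ext_add lin_ext_smult lin_ext_fun_add lin_ext_fun_smult)
    (simp add: lin_ext_def)

lemma tensor_algmult: "(f \<otimes> g) \<star> (f' \<otimes> g') = (f \<star> f') \<otimes> (g \<star> g')"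
proof (induction f rule: linear_induct)
  case (basis a)
  show ?case
  proof (induction g rule: linear_induct)
    case (basis b)
    show ?case
    proof (induction f' rule: linear_induct)
      case (basis a')
      show ?case
        by (induction g' rule: linear_induct) (simp_all add: algmult_linear tensor_linear)
    qed (simp_all add: algmult_linear tensor_linear)
  qed (simp_all add: algmult_linear tensor_linear)
qed (simp_all add: algmult_linear tensor_linear)

lemma hom_ext_gen: "hom_ext \<sigma> (gen x) = \<sigma> x"
  by (simp add: hom_ext_def gen_def)

lemma eval_mon_mprod: "eval_mon \<sigma> (mprod a b) = eval_mon \<sigma> a \<star> eval_mon \<sigma> b"
  by (cases a; cases b) simp_all

lemma hom_ext_algmult: "hom_ext \<sigma> (f \<star> g) = hom_ext \<sigma> f \<star> hom_ext \<sigma> g"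
  unfolding hom_ext_def
proof (induction f rule: linear_induct)
  case (basis a)
  show ?case
    by (induction g rule: linear_induct)
      (simp_all add: eval_mon_mprod algmult_linear lin_ext_add lin_ext_smult)
qed (simp_all add: algmult_linear lin_ext_add lin_ext_smult)

lemma hom_ext_hom: "unital_algebra_hom (hom_ext \<sigma>)"
  using hom_ext_algmult[of \<sigma>]
  by (simp add: unital_algebra_hom_def algone_def mone_nonassoc_mon_def hom_ext_def
      lin_ext_add lin_ext_smult)

lemma hom_ext_unique:
  fixes h :: "('x, 'k::comm_ring_1) nonassoc_poly \<Rightarrow> ('m::unital_magma \<Rightarrow>\<^sub>0 'k)"
  assumes "unital_algebra_hom h" "\<And>x. h (gen x) = \<sigma> x"
  shows "h = hom_ext \<sigma>"
proof
  fix f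
  have tree: "h (basis (Brword t)) = eval_brword \<sigma> t" for t
  proof (induction t)
    case (Bracket s t)
    have "basis (Brword (Bracket s t)) =
        (basis (Brword s) \<star> basis (Brword t) :: ('x, 'k) nonassoc_poly)"
      by simp
    with Bracket assms(1) show ?case
      by (metis unital_algebra_hom_def eval_brword.simps(2))
  qed (use assms(2) in \<open>simp add: gen_def\<close>)
  have zero: "h 0 = 0"
    using assms(1) unfolding unital_algebra_hom_def by (metis smult_0(1))
  show "h f = hom_ext \<sigma> f"
    unfolding hom_ext_def
  proof (induction f rule: linear_induct)
    case (basis m)
    show ?case
      using assms(1) tree
      by (cases m) (simp_all add: unital_algebra_hom_def algone_def mone_nonassoc_mon_def)
  qed (use assms(1) zero in \<open>simp_all add: unital_algebra_hom_def lin_ext_add lin_ext_smult\<close>)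
qed

lemma coaddition_hom: "unital_algebra_hom coaddition"
  by (simp add: coaddition_def hom_ext_hom)

lemma coaddition_gen: "coaddition (gen x) = gen x \<otimes> algone + algone \<otimes> gen x"
  by (simp add: coaddition_def hom_ext_gen)

lemma composition_gen:
  "inj_on v {..<n} \<Longrightarrow> i < n \<Longrightarrow> composition n v (gen (v i)) g = g i"
  by (simp add: composition_def hom_ext_gen)

end

theory Submission
  imports Defs
begin

text \<open>
  Both parts express that certain operators are compatible with the co-addition \<open>\<Delta>\<close>.

  For (i), let \<open>h\<close> be the substitution homomorphism.  If \<open>h\<close> sends every variable to a
  primitive element, then \<open>\<Delta> \<circ> h\<close> and \<open>(h \<otimes> h) \<circ> \<Delta>\<close> are two homomorphisms that agree on the
  variables, hence they are equal (\<open>coaddition_hom_ext\<close>).  Evaluating both at a primitive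
  \<open>f\<close> gives \<open>\<Delta> (h f) = h f \<otimes> 1 + 1 \<otimes> h f\<close>.

  For (ii), let each variable \<open>x\<close> act on \<open>K{X}\<close> by left multiplication.  Since operators
  compose associatively, this extends to an action of \<open>K\<langle>X\<rangle>\<close>, and acting on \<open>1\<close> produces
  exactly the right normed brackets (\<open>right_normed_action\<close>).  As \<open>x\<close> is primitive, its left
  multiplication \<open>D\<close> is a coderivation, that is, \<open>\<Delta> \<circ> D = (D \<otimes> id + id \<otimes> D) \<circ> \<Delta>\<close>.
  Coderivations form a Lie algebra of operators, because the mixed terms \<open>D \<otimes> E + E \<otimes> D\<close>
  cancel in a commutator (\<open>coderivation_commutator\<close>).  So every Lie polynomial acts by a
  coderivation, and a coderivation maps \<open>1\<close>, for which \<open>\<Delta> 1 = 1 \<otimes> 1\<close>, to a primitive element.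
\<close>

section \<open>Linear operators and their tensor products\<close>

definition linear_op :: "(('m \<Rightarrow>\<^sub>0 'k::comm_ring_1) \<Rightarrow> ('n \<Rightarrow>\<^sub>0 'k)) \<Rightarrow> bool"
  where "linear_op h \<longleftrightarrow>
    (\<forall>f g. h (f + g) = h f + h g) \<and> (\<forall>c f. h (smult c f) = smult c (h f))"

lemma
  assumes "linear_op h"
  shows linear_op_add: "h (f + g) = h f + h g"
    and linear_op_smult: "h (smult c f) = smult c (h f)"
    and linear_op_zero: "h 0 = 0"
proof -
  show "h (f + g) = h f + h g" and smult: "h (smult c f) = smult c (h f)" for c f
    using assms by (simp_all add: linear_op_def)
  show "h 0 = 0"
    using smult[of 0 0] by simp
qed

lemma diff_eq_add_smult: "f - g = f + smult (- 1) g"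
  by (rule poly_mapping_eqI) (simp add: lookup_add lookup_minus)

lemma smult_diff: "smult c (f - g) = smult c f - smult c g"
  by (rule poly_mapping_eqI) (simp add: lookup_minus algebra_simps)

lemma linear_op_diff: "linear_op h \<Longrightarrow> h (f - g) = h f - h g"
  by (simp add: diff_eq_add_smult linear_op_add linear_op_smult)

lemma unital_algebra_hom_linear: "unital_algebra_hom h \<Longrightarrow> linear_op h"
  by (simp add: unital_algebra_hom_def linear_op_def)

lemma linear_op_lin_ext: "linear_op (lin_ext \<phi>)"
  by (simp add: linear_op_def lin_ext_add lin_ext_smult)

lemma linear_op_id: "linear_op (\<lambda>f. f)"
  by (simp add: linear_op_def)

lemma linear_op_compose: "linear_op h \<Longrightarrow> linear_op k \<Longrightarrow> linear_op (\<lambda>f. h (k f))"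
  by (simp add: linear_op_def)

lemma linear_op_plus: "linear_op h \<Longrightarrow> linear_op k \<Longrightarrow> linear_op (\<lambda>f. h f + k f)"
  by (simp add: linear_op_def smult_add algebra_simps)

lemma linear_op_minus: "linear_op h \<Longrightarrow> linear_op k \<Longrightarrow> linear_op (\<lambda>f. h f - k f)"
  by (simp add: linear_op_def smult_diff algebra_simps)

lemma linear_op_scale: "linear_op h \<Longrightarrow> linear_op (\<lambda>f. smult c (h f))"
  by (simp add: linear_op_def smult_add smult_smult mult.commute)

lemma linear_op_algmult: "linear_op (\<lambda>g. f \<star> g)"
  by (simp add: linear_op_def algmult_linear)

definition tensor_map ::
    "(('a \<Rightarrow>\<^sub>0 'k::comm_ring_1) \<Rightarrow> ('c \<Rightarrow>\<^sub>0 'k)) \<Rightarrow> (('b \<Rightarrow>\<^sub>0 'k) \<Rightarrow> ('d \<Rightarrow>\<^sub>0 'k)) \<Rightarrow>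
     ('a \<times> 'b \<Rightarrow>\<^sub>0 'k) \<Rightarrow> ('c \<times> 'd \<Rightarrow>\<^sub>0 'k)"
  where "tensor_map h k = lin_ext (\<lambda>(a, b). h (basis a) \<otimes> k (basis b))"

lemma linear_op_tensor_map: "linear_op (tensor_map h k)"
  by (simp add: tensor_map_def linear_op_lin_ext)

lemmas tensor_map_linear =
  linear_op_add[OF linear_op_tensor_map]
  linear_op_smult[OF linear_op_tensor_map]
  linear_op_zero[OF linear_op_tensor_map]

lemma tensor_map_basis [simp]: "tensor_map h k (basis (a, b)) = h (basis a) \<otimes> k (basis b)"
  by (simp add: tensor_map_def)

lemma tensor_map_tensor:
  assumes "linear_op h" "linear_op k"
  shows "tensor_map h k (f \<otimes> g) = h f \<otimes> k g"
proof (induction f rule: linear_induct)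
  case (basis a)
  show ?case
    by (induction g rule: linear_induct)
      (simp_all add: tensor_linear tensor_map_linear linear_op_add[OF assms(2)]
        linear_op_smult[OF assms(2)] linear_op_zero[OF assms(2)])
qed (simp_all add: tensor_linear tensor_map_linear linear_op_add[OF assms(1)]
      linear_op_smult[OF assms(1)] linear_op_zero[OF assms(1)])

lemma linear_op_eqI:
  assumes "linear_op h" "linear_op k" "\<And>a b. h (basis (a, b)) = k (basis (a, b))"
  shows "h t = k t"
proof (induction t rule: linear_induct)
  case (basis m)
  show ?case
    using assms(3) by (cases m) simp
qed (simp_all add: linear_op_add[OF assms(1)] linear_op_add[OF assms(2)]
      linear_op_smult[OF assms(1)] linear_op_smult[OF assms(2)]
      linear_op_zero[OF assms(1)] linear_op_zero[OF assms(2)])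

lemma tensor_map_compose:
  assumes "linear_op h" "linear_op k"
  shows "tensor_map h k (tensor_map h' k' t) = tensor_map (\<lambda>f. h (h' f)) (\<lambda>f. k (k' f)) t"
  by (rule linear_op_eqI)
    (simp_all add: tensor_map_tensor assms linear_op_compose linear_op_tensor_map)

lemma tensor_map_fun_add:
  "tensor_map (\<lambda>f. h f + h' f) k t = tensor_map h k t + tensor_map h' k t"
  "tensor_map h (\<lambda>f. k f + k' f) t = tensor_map h k t + tensor_map h k' t"
  by (rule linear_op_eqI; simp add: tensor_linear linear_op_plus linear_op_tensor_map)+

lemma tensor_map_fun_smult:
  "tensor_map (\<lambda>f. smult c (h f)) k t = smult c (tensor_map h k t)"
  "tensor_map h (\<lambda>f. smult c (k f)) t = smult c (tensor_map h k t)"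
  by (rule linear_op_eqI; simp add: tensor_linear linear_op_scale linear_op_tensor_map)+

lemma tensor_map_fun_diff:
  "tensor_map (\<lambda>f. h f - h' f) k t = tensor_map h k t - tensor_map h' k t"
  "tensor_map h (\<lambda>f. k f - k' f) t = tensor_map h k t - tensor_map h k' t"
  by (simp_all add: diff_eq_add_smult tensor_map_fun_add tensor_map_fun_smult)

lemma tensor_map_algmult:
  assumes "unital_algebra_hom h" "unital_algebra_hom k"
  shows "tensor_map h k (s \<star> t) = tensor_map h k s \<star> tensor_map h k t"
proof -
  have mult: "h (f \<star> g) = h f \<star> h g" "k (f' \<star> g') = k f' \<star> k g'" for f g f' g'
    using assms by (simp_all add: unital_algebra_hom_def)
  have hb: "h (basis (mprod a b)) = h (basis a) \<star> h (basis b)" for a b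
    using mult(1)[of "basis a" "basis b"] by simp
  have kb: "k (basis (mprod a b)) = k (basis a) \<star> k (basis b)" for a b
    using mult(2)[of "basis a" "basis b"] by simp
  show ?thesis
  proof (induction s rule: linear_induct)
    case (basis m)
    show ?case
    proof (induction t rule: linear_induct)
      case (basis n)
      show ?case
        by (cases m; cases n) (simp add: tensor_algmult hb kb)
    qed (simp_all add: algmult_linear tensor_map_linear)
  qed (simp_all add: algmult_linear tensor_map_linear)
qed

lemma algone_prod: "algone = algone \<otimes> algone"
  by (simp add: algone_def mone_prod_def)

lemma tensor_map_hom:
  assumes "unital_algebra_hom h" "unital_algebra_hom k"
  shows "unital_algebra_hom (tensor_map h k)"
proof -
  have one: "h algone = algone" "k algone = algone"
    using assms by (simp_all add: unital_algebra_hom_def)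
  have "tensor_map h k algone = algone"
    by (simp add: algone_prod tensor_map_tensor assms unital_algebra_hom_linear one)
  then show ?thesis
    by (simp add: unital_algebra_hom_def tensor_map_algmult[OF assms] tensor_map_linear)
qed

lemma unital_algebra_hom_comp:
  "unital_algebra_hom h \<Longrightarrow> unital_algebra_hom k \<Longrightarrow> unital_algebra_hom (\<lambda>f. h (k f))"
  by (simp add: unital_algebra_hom_def)


section \<open>Polynomials in a given set of variables\<close>

lemma free_nonassoc_basis [simp]: "basis m \<in> free_nonassoc X \<longleftrightarrow> monvars m \<subseteq> X"
  by (simp add: free_nonassoc_def)

lemma free_nonassoc_zero: "0 \<in> free_nonassoc X"
  by (simp add: free_nonassoc_def)

lemma free_nonassoc_add:
  "f \<in> free_nonassoc X \<Longrightarrow> g \<in> free_nonassoc X \<Longrightarrow> f + g \<in> free_nonassoc X"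
  using Poly_Mapping.keys_add[of f g] unfolding free_nonassoc_def by blast

lemma free_nonassoc_smult: "f \<in> free_nonassoc X \<Longrightarrow> smult c f \<in> free_nonassoc X"
  by (auto simp: free_nonassoc_def in_keys_iff)

lemma free_nonassoc_diff:
  "f \<in> free_nonassoc X \<Longrightarrow> g \<in> free_nonassoc X \<Longrightarrow> f - g \<in> free_nonassoc X"
  by (simp add: diff_eq_add_smult free_nonassoc_add free_nonassoc_smult)

lemma free_nonassoc_lin_ext:
  assumes "\<And>m. m \<in> Poly_Mapping.keys f \<Longrightarrow> \<phi> m \<in> free_nonassoc X"
  shows "lin_ext \<phi> f \<in> free_nonassoc X"
proof -
  have "(\<Sum>m\<in>S. smult (Poly_Mapping.lookup f m) (\<phi> m)) \<in> free_nonassoc X"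
    if "finite S" "S \<subseteq> Poly_Mapping.keys f" for S
    using that
    by (induction rule: finite_induct)
      (simp_all add: assms free_nonassoc_zero free_nonassoc_add free_nonassoc_smult)
  then show ?thesis
    by (simp add: lin_ext_def)
qed

lemma monvars_mprod: "monvars (mprod a b) = monvars a \<union> monvars b"
  by (cases a; cases b) auto

lemma free_nonassoc_algmult:
  "f \<in> free_nonassoc X \<Longrightarrow> g \<in> free_nonassoc X \<Longrightarrow> f \<star> g \<in> free_nonassoc X"
  unfolding algmult_def
  by (intro free_nonassoc_lin_ext) (simp add: free_nonassoc_def monvars_mprod)

lemma free_nonassoc_algone: "algone \<in> free_nonassoc X"
  by (simp add: algone_def mone_nonassoc_mon_def)

lemma free_nonassoc_gen: "x \<in> X \<Longrightarrow> gen x \<in> free_nonassoc X"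
  by (simp add: gen_def)

lemma eval_brword_free_nonassoc:
  "(\<And>x. x \<in> set_brword t \<Longrightarrow> \<sigma> x \<in> free_nonassoc X) \<Longrightarrow> eval_brword \<sigma> t \<in> free_nonassoc X"
  by (induction t) (simp_all add: free_nonassoc_algmult)

lemma hom_ext_free_nonassoc:
  assumes "f \<in> free_nonassoc V" "\<And>x. x \<in> V \<Longrightarrow> \<sigma> x \<in> free_nonassoc X"
  shows "hom_ext \<sigma> f \<in> free_nonassoc X"
  unfolding hom_ext_def
proof (rule free_nonassoc_lin_ext)
  fix m assume "m \<in> Poly_Mapping.keys f"
  with assms(1) have "monvars m \<subseteq> V"
    by (simp add: free_nonassoc_def)
  then show "eval_mon \<sigma> m \<in> free_nonassoc X"
    using assms(2)
    by (cases m) (auto intro!: eval_brword_free_nonassoc free_nonassoc_algone)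
qed

lemma eval_brword_cong:
  "(\<And>x. x \<in> set_brword t \<Longrightarrow> \<sigma> x = \<tau> x) \<Longrightarrow> eval_brword \<sigma> t = eval_brword \<tau> t"
  by (induction t) simp_all

lemma hom_ext_cong:
  assumes "f \<in> free_nonassoc V" "\<And>x. x \<in> V \<Longrightarrow> \<sigma> x = \<tau> x"
  shows "hom_ext \<sigma> f = hom_ext \<tau> f"
  unfolding hom_ext_def lin_ext_def
proof (rule sum.cong[OF refl])
  fix m assume "m \<in> Poly_Mapping.keys f"
  with assms(1) have "monvars m \<subseteq> V"
    by (simp add: free_nonassoc_def)
  then have "eval_mon \<sigma> m = eval_mon \<tau> m"
    using assms(2) by (cases m) (auto intro: eval_brword_cong)
  then show "smult (Poly_Mapping.lookup f m) (eval_mon \<sigma> m) =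
      smult (Poly_Mapping.lookup f m) (eval_mon \<tau> m)"
    by simp
qed


section \<open>Substitution of primitive elements\<close>

abbreviation primitive :: "('x, 'k::comm_ring_1) nonassoc_poly \<Rightarrow> bool"
  where "primitive f \<equiv> coaddition f = f \<otimes> algone + algone \<otimes> f"

lemma coaddition_algone: "coaddition algone = algone \<otimes> algone"
  by (simp add: coaddition_hom[unfolded unital_algebra_hom_def] algone_prod[symmetric])

lemma coaddition_algmult: "coaddition (f \<star> g) = coaddition f \<star> coaddition g"
  by (simp add: coaddition_hom[unfolded unital_algebra_hom_def])

lemmas coaddition_linear_op = unital_algebra_hom_linear[OF coaddition_hom]

text \<open>
  Both sides are unital algebra homomorphisms in \<open>f\<close>, so it is enough to compare them on a
  variable \<open>x\<close>, where they agree exactly because \<open>\<sigma> x\<close> is primitive.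
\<close>

lemma coaddition_hom_ext:
  assumes "\<And>x. primitive (\<sigma> x)"
  shows "coaddition (hom_ext \<sigma> f) = tensor_map (hom_ext \<sigma>) (hom_ext \<sigma>) (coaddition f)"
proof -
  let ?\<tau> = "\<lambda>x. \<sigma> x \<otimes> algone + algone \<otimes> \<sigma> x"
  have one: "hom_ext \<sigma> algone = algone"
    using hom_ext_hom[of \<sigma>] by (simp add: unital_algebra_hom_def)
  have lin: "linear_op (hom_ext \<sigma>)"
    by (simp add: hom_ext_hom unital_algebra_hom_linear)
  have "(\<lambda>f. coaddition (hom_ext \<sigma> f)) = hom_ext ?\<tau>"
    by (rule hom_ext_unique)
      (simp_all add: unital_algebra_hom_comp coaddition_hom hom_ext_hom hom_ext_gen assms)
  moreover have "(\<lambda>f. tensor_map (hom_ext \<sigma>) (hom_ext \<sigma>) (coaddition f)) = hom_ext ?\<tau>"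
    by (rule hom_ext_unique)
      (simp_all add: unital_algebra_hom_comp tensor_map_hom coaddition_hom hom_ext_hom
        coaddition_gen tensor_map_linear tensor_map_tensor[OF lin lin] hom_ext_gen one)
  ultimately show ?thesis
    by metis
qed

theorem hom_ext_pseudo_linear:
  assumes "f \<in> pseudo_linear V" "\<And>x. x \<in> V \<Longrightarrow> \<sigma> x \<in> pseudo_linear X"
  shows "hom_ext \<sigma> f \<in> pseudo_linear X"
proof -
  have f: "f \<in> free_nonassoc V" "primitive f"
    using assms(1) by (simp_all add: pseudo_linear_def)
  \<comment> \<open>Only the values of \<open>\<sigma>\<close> on \<open>V\<close> matter, and \<open>0\<close> is primitive.\<close>
  define \<tau> where "\<tau> = (\<lambda>x. if x \<in> V then \<sigma> x else 0)"
  have eq: "hom_ext \<sigma> f = hom_ext \<tau> f"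
    by (rule hom_ext_cong[OF f(1)]) (simp add: \<tau>_def)
  have "primitive (\<tau> x)" for x
    using assms(2)
    by (simp add: \<tau>_def pseudo_linear_def tensor_linear linear_op_zero[OF coaddition_linear_op])
  then have "coaddition (hom_ext \<tau> f) = tensor_map (hom_ext \<tau>) (hom_ext \<tau>) (coaddition f)"
    by (rule coaddition_hom_ext)
  moreover have "linear_op (hom_ext \<tau>)" "hom_ext \<tau> algone = algone"
    using hom_ext_hom[of \<tau>] by (simp_all add: unital_algebra_hom_linear unital_algebra_hom_def)
  ultimately have "primitive (hom_ext \<tau> f)"
    by (simp add: f(2) tensor_map_linear tensor_map_tensor)
  moreover have "hom_ext \<sigma> f \<in> free_nonassoc X"
    by (rule hom_ext_free_nonassoc[OF f(1)]) (use assms(2) in \<open>simp add: pseudo_linear_def\<close>)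
  ultimately show ?thesis
    by (simp add: pseudo_linear_def eq)
qed


section \<open>Coderivations\<close>

definition coderivation ::
    "(('x, 'k::comm_ring_1) nonassoc_poly \<Rightarrow> ('x, 'k) nonassoc_poly) \<Rightarrow> bool"
  where "coderivation D \<longleftrightarrow> linear_op D \<and>
    (\<forall>p. coaddition (D p) =
      tensor_map D (\<lambda>q. q) (coaddition p) + tensor_map (\<lambda>q. q) D (coaddition p))"

lemma coderivation_linear: "coderivation D \<Longrightarrow> linear_op D"
  by (simp add: coderivation_def)

lemma coaddition_coderivation:
  "coderivation D \<Longrightarrow> coaddition (D p) =
    tensor_map D (\<lambda>q. q) (coaddition p) + tensor_map (\<lambda>q. q) D (coaddition p)"
  by (simp add: coderivation_def)

lemma coderivation_add:
  "coderivation D \<Longrightarrow> coderivation E \<Longrightarrow> coderivation (\<lambda>p. D p + E p)"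
  by (simp add: coderivation_def linear_op_plus linear_op_add[OF coaddition_linear_op]
      tensor_map_fun_add algebra_simps)

lemma coderivation_smult: "coderivation D \<Longrightarrow> coderivation (\<lambda>p. smult c (D p))"
  by (simp add: coderivation_def linear_op_scale linear_op_smult[OF coaddition_linear_op]
      tensor_map_fun_smult smult_add)

text \<open>
  The composite of two coderivations is not a coderivation: it satisfies the defining identity
  up to mixed terms that are symmetric in the two operators, so they cancel in the commutator.
\<close>

lemma coaddition_coderivation_compose:
  assumes "coderivation D" "coderivation E"
  shows "coaddition (D (E p)) =
    tensor_map (\<lambda>q. D (E q)) (\<lambda>q. q) (coaddition p) +
    tensor_map (\<lambda>q. q) (\<lambda>q. D (E q)) (coaddition p) +
    (tensor_map D E (coaddition p) + tensor_map E D (coaddition p))"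
  by (simp add: coaddition_coderivation[OF assms(1)] coaddition_coderivation[OF assms(2)]
      tensor_map_linear tensor_map_compose coderivation_linear[OF assms(1)] linear_op_id
      algebra_simps)

lemma coderivation_commutator:
  assumes "coderivation D" "coderivation E"
  shows "coderivation (\<lambda>p. D (E p) - E (D p))"
  unfolding coderivation_def
  by (simp add: linear_op_minus linear_op_compose coderivation_linear assms
      linear_op_diff[OF coaddition_linear_op] coaddition_coderivation_compose
      tensor_map_fun_diff)

text \<open>
  On the tensor square, left multiplication by \<open>f \<otimes> 1\<close> and by \<open>1 \<otimes> f\<close> is \<open>D \<otimes> id\<close> and
  \<open>id \<otimes> D\<close>, where \<open>D\<close> is left multiplication by \<open>f\<close>.  As \<open>\<Delta>\<close> is multiplicative, primitivity
  of \<open>f\<close> therefore is the coderivation property of \<open>D\<close>, whether or not products associate.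
\<close>

lemma coderivation_algmult:
  assumes "primitive f"
  shows "coderivation (\<lambda>p. f \<star> p)"
proof -
  have "(f \<otimes> algone) \<star> basis (a, b) = (f \<star> basis a) \<otimes> basis b"
    and "(algone \<otimes> f) \<star> basis (a, b) = basis a \<otimes> (f \<star> basis b)" for a b
    using tensor_algmult[of f algone "basis a" "basis b"]
      tensor_algmult[of algone f "basis a" "basis b"] by simp_all
  then have "(f \<otimes> algone) \<star> t = tensor_map (\<lambda>p. f \<star> p) (\<lambda>q. q) t"
    and "(algone \<otimes> f) \<star> t = tensor_map (\<lambda>q. q) (\<lambda>p. f \<star> p) t" for t
    by (rule_tac [!] linear_op_eqI[OF linear_op_algmult linear_op_tensor_map]) simp_all
  then show ?thesis
    by (simp add: coderivation_def linear_op_algmult coaddition_algmult assms algmult_linear)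
qed

lemma coderivation_zero: "coderivation (\<lambda>p. 0)"
  using coderivation_algmult[of 0]
  by (simp add: algmult_linear tensor_linear linear_op_zero[OF coaddition_linear_op])

lemma coderivation_algone_primitive:
  assumes "coderivation D"
  shows "primitive (D algone)"
  by (simp add: coaddition_coderivation[OF assms] coaddition_algone tensor_map_tensor
      coderivation_linear[OF assms] linear_op_id)


section \<open>The action of the free associative algebra by left multiplications\<close>

definition word_action ::
    "'x assoc_word \<Rightarrow> ('x, 'k::comm_ring_1) nonassoc_poly \<Rightarrow> ('x, 'k) nonassoc_poly"
  where "word_action w p = foldr (\<lambda>x q. gen x \<star> q) (letters w) p"

definition action ::
    "('x, 'k::comm_ring_1) assoc_poly \<Rightarrow> ('x, 'k) nonassoc_poly \<Rightarrow> ('x, 'k) nonassoc_poly"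
  where "action f p = lin_ext (\<lambda>w. word_action w p) f"

lemma word_action_algone: "word_action w algone = basis (right_normed_mon w)"
proof -
  have "foldr (\<lambda>x q. gen x \<star> q) xs algone =
      basis (foldr (\<lambda>x m. mprod (Brword (Letter x)) m) xs mone)" for xs :: "'a list"
    by (induction xs) (simp_all add: algone_def gen_def)
  then show ?thesis
    by (simp add: word_action_def right_normed_mon_def)
qed

lemma right_normed_action: "right_normed f = action f algone"
  by (simp add: right_normed_def action_def word_action_algone)

lemma linear_op_word_action: "linear_op (word_action w)"
proof -
  have "linear_op (foldr (\<lambda>x q. gen x \<star> q) xs)" for xs :: "'a list"
    by (induction xs) (simp_all add: linear_op_def algmult_linear)
  then show ?thesis
    by (simp add: linear_op_def word_action_def)
qed

lemma linear_op_action: "linear_op (action f)"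
  by (simp add: linear_op_def action_def linear_op_add[OF linear_op_word_action]
      linear_op_smult[OF linear_op_word_action] lin_ext_fun_add lin_ext_fun_smult)

lemma action_gen: "action (basis (Assoc_Word [x])) p = gen x \<star> p"
  by (simp add: action_def word_action_def)

lemma action_zero: "action 0 p = 0"
  by (simp add: action_def)

lemma action_add: "action (f + g) p = action f p + action g p"
  by (simp add: action_def lin_ext_add)

lemma action_smult: "action (smult c f) p = smult c (action f p)"
  by (simp add: action_def lin_ext_smult)

lemma action_diff: "action (f - g) p = action f p - action g p"
  by (simp add: diff_eq_add_smult action_add action_smult)

text \<open>
  Scalars act on \<open>K\<langle>X\<rangle>\<close> as multiples of the empty word.  To prove this, products of terms with
  coefficients are compared, so terms replace basis elements and the scalar step disappears.
\<close>

lemma single_induct [case_names single zero add]: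
  assumes "\<And>m c. P (Poly_Mapping.single m c)" "P 0" "\<And>f g. P f \<Longrightarrow> P g \<Longrightarrow> P (f + g)"
  shows "P (f :: 'm \<Rightarrow>\<^sub>0 'k::comm_ring_1)"
proof -
  have "\<forall>c. P (smult c f)"
    by (induction f rule: linear_induct)
      (simp_all add: smult_basis smult_add smult_smult assms)
  then have "P (smult 1 f)"
    by blast
  then show ?thesis
    by simp
qed

lemma assoc_mult_smult:
  fixes f g :: "('x, 'k::comm_ring_1) assoc_poly"
  shows "smult c f * g = smult c (f * g)" "f * smult c g = smult c (f * g)"
proof -
  have single: "smult c (Poly_Mapping.single w d) = Poly_Mapping.single w (c * d)"
    for c d :: 'k and w :: "'x assoc_word"
    by (rule poly_mapping_eqI) (simp add: lookup_single when_def)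
  have scalar: "smult c f = Poly_Mapping.single 0 c * f" for c and f :: "('x, 'k) assoc_poly"
    by (induction f rule: single_induct)
      (simp_all add: single mult_single smult_add distrib_left)
  have central: "f * Poly_Mapping.single 0 c = Poly_Mapping.single 0 c * f"
    for c and f :: "('x, 'k) assoc_poly"
    by (induction f rule: single_induct)
      (simp_all add: mult_single mult.commute distrib_left distrib_right)
  show "smult c f * g = smult c (f * g)"
    by (simp add: scalar mult.assoc)
  have "f * smult c g = (f * Poly_Mapping.single 0 c) * g"
    by (simp add: scalar mult.assoc)
  then show "f * smult c g = smult c (f * g)"
    by (simp add: central scalar mult.assoc)
qed

text \<open>
  The brackets of \<open>K{X}\<close> are not rearranged here: a product in \<open>K\<langle>X\<rangle>\<close> acts as a composite of
  operators, and composition is associative.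
\<close>

lemma action_mult: "action (f * g) p = action f (action g p)"
proof (induction f rule: linear_induct)
  case (basis u)
  show ?case
  proof (induction g rule: linear_induct)
    case (basis w)
    show ?case
      by (simp add: action_def mult_single word_action_def plus_assoc_word_def)
  qed (simp_all add: action_zero action_add action_smult distrib_left assoc_mult_smult
      linear_op_zero[OF linear_op_action] linear_op_add[OF linear_op_action]
      linear_op_smult[OF linear_op_action])
qed (simp_all add: action_zero action_add action_smult distrib_right assoc_mult_smult)

lemma lie_polynomial_coderivation:
  assumes "f \<in> lie_polynomials X"
  shows "coderivation (action f)"
  using assms
proof induction
  case (gen x)
  show ?case
    unfolding action_gen[abs_def] by (rule coderivation_algmult) (rule coaddition_gen)
next
  case zero
  show ?case
    unfolding action_zero[abs_def] by (rule coderivation_zero)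
next
  case (add f g)
  then show ?case
    unfolding action_add[abs_def] by (rule_tac coderivation_add)
next
  case (scale f c)
  then show ?case
    unfolding action_smult[abs_def] by (rule_tac coderivation_smult)
next
  case (commutator f g)
  then show ?case
    unfolding action_diff[abs_def] action_mult by (rule_tac coderivation_commutator)
qed

lemma lie_polynomial_action_free_nonassoc:
  "f \<in> lie_polynomials X \<Longrightarrow> p \<in> free_nonassoc X \<Longrightarrow> action f p \<in> free_nonassoc X"
  by (induction arbitrary: p rule: lie_polynomials.induct)
    (simp_all add: action_gen action_zero action_add action_smult action_diff action_mult
      free_nonassoc_gen free_nonassoc_algmult free_nonassoc_zero free_nonassoc_add
      free_nonassoc_smult free_nonassoc_diff)

theorem right_normed_lie_pseudo_linear:
  assumes "f \<in> lie_polynomials X"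
  shows "right_normed f \<in> pseudo_linear X"
  by (simp add: pseudo_linear_def right_normed_action coderivation_algone_primitive
      lie_polynomial_coderivation[OF assms] lie_polynomial_action_free_nonassoc[OF assms]
      free_nonassoc_algone)


section \<open>Composition and right normed Lie polynomials\<close>

theorem lemma5p3:
  fixes X :: "'x set"
  assumes "countable X"
  shows
    "(\<forall>n (v :: nat \<Rightarrow> 'x) (f :: ('x, 'k::field_char_0) nonassoc_poly)
        (g :: nat \<Rightarrow> ('x, 'k) nonassoc_poly).
        (infinite X \<or> n \<le> card X) \<longrightarrow>
        inj_on v {..<n} \<longrightarrow> v ` {..<n} \<subseteq> X \<longrightarrow>
        f \<in> pseudo_linear (v ` {..<n}) \<longrightarrow>
        (\<forall>i<n. g i \<in> pseudo_linear X) \<longrightarrow>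
        composition n v f g \<in> pseudo_linear X)
     \<and>
     ((infinite X \<or> 2 \<le> card X) \<longrightarrow>
        (\<forall>f :: ('x, 'k) assoc_poly. f \<in> lie_polynomials X \<longrightarrow>
          right_normed f \<in> pseudo_linear X))"
proof (intro conjI allI impI)
  fix n and v :: "nat \<Rightarrow> 'x" and f :: "('x, 'k) nonassoc_poly"
    and g :: "nat \<Rightarrow> ('x, 'k) nonassoc_poly"
  assume f: "f \<in> pseudo_linear (v ` {..<n})" and g: "\<forall>i<n. g i \<in> pseudo_linear X"
  show "composition n v f g \<in> pseudo_linear X"
    unfolding composition_def
  proof (rule hom_ext_pseudo_linear[OF f])
    fix x assume "x \<in> v ` {..<n}"
    then have "inv_into {..<n} v x \<in> {..<n}"
      by (rule inv_into_into)
    with g show "g (inv_into {..<n} v x) \<in> pseudo_linear X"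
      by simp
  qed
next
  fix f :: "('x, 'k) assoc_poly"
  assume "f \<in> lie_polynomials X"
  then show "right_normed f \<in> pseudo_linear X"
    by (rule right_normed_lie_pseudo_linear)
qed

end
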